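(* Let $B\subseteq\mathbb{R}$ be an $F_\sigma$ subgroup of $(\mathbb{R},+)$, and let $\xi\in\mathbb{R}\setminus\mathbb{Q}$. There is an $F_\sigma$ subgroup $A$ of $(\mathbb{R},+)$ such that $$B\subseteq A,\qquad \dim_{\mathrm H} A=\dim_{\mathrm H} B,\qquad A+\xi A=\mathbb{R}.$$
   Context: $\dim_{\mathrm H}$ denotes Hausdorff dimension with respect to the Euclidean metric. For $A\subseteq\mathbb{R}$ and $\xi\in\mathbb{R}$, $A+\xi A=\{a+\xi b: a,b\in A\}$. $F_\sigma$ means a countable union of closed subsets of $\mathbb{R}$. *)

theory Defs
  imports "HOL-Analysis.Analysis" "HOL-Algebra.Group"
begin

definition real_add_group :: "real monoid" where
  "real_add_group = \<lparr>carrier = UNIV, monoid.mult = (+), one = (0::real)\<rparr>"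

lemma group_real_add_group: "group real_add_group"
  by (rule groupI) (auto simp: real_add_group_def intro: exI[of _ "- x" for x :: real])

lemma inv_real_add_group: "inv\<^bsub>real_add_group\<^esub> x = - x"
  by (rule group.inv_equality[OF group_real_add_group]) (simp_all add: real_add_group_def)

lemma subgroup_real_add_group_iff:
  "subgroup H real_add_group \<longleftrightarrow>
     0 \<in> H \<and> (\<forall>x\<in>H. \<forall>y\<in>H. x + y \<in> H) \<and> (\<forall>x\<in>H. - x \<in> H)"
  unfolding subgroup_def inv_real_add_group by (auto simp: real_add_group_def)

(* diam(U)^s with the usual conventions: the empty set contributes 0, and 0^0 = 1 for nonempty
   sets, so that the 0-dimensional measure is counting measure (whereas 0 powr 0 = 0). *)
definition diam_power :: "real \<Rightarrow> 'a::metric_space set \<Rightarrow> ennreal" where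
  "diam_power s U =
     (if U = {} then 0 else if s = 0 then 1 else ennreal (diameter U powr s))"

(* Boundedness is required explicitly because diameter has no meaningful value on unbounded
   sets. Finite covers are included by padding with the empty set. *)
definition hausdorff_premeasure :: "real \<Rightarrow> real \<Rightarrow> 'a::metric_space set \<Rightarrow> ennreal" where
  "hausdorff_premeasure s \<delta> A =
     (INF U \<in> {U :: nat \<Rightarrow> 'a set. A \<subseteq> (\<Union>i. U i) \<and>
                 (\<forall>i. bounded (U i) \<and> diameter (U i) \<le> \<delta>)}.
        (\<Sum>i. diam_power s (U i)))"

definition hausdorff_outer_measure :: "real \<Rightarrow> 'a::metric_space set \<Rightarrow> ennreal" where
  "hausdorff_outer_measure s A = (SUP \<delta> \<in> {0<..}. hausdorff_premeasure s \<delta> A)"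

(* The infimum is taken in ennreal, so it is infinite if no exponent s qualifies. *)
definition hausdorff_dim :: "'a::metric_space set \<Rightarrow> ennreal" where
  "hausdorff_dim A = (INF s \<in> {s. 0 \<le> s \<and> hausdorff_outer_measure s A = 0}. ennreal s)"

end

theory Submission
  imports Defs
begin

text \<open>
  Let \<open>d\<close> be the dimension of \<open>B\<close>, and write \<open>B\<close> as an increasing union of compact sets \<open>K n\<close>.
  The subgroup \<open>A\<close> is generated by \<open>B\<close> and by the numbers \<open>a x\<close> and \<open>b x\<close>, where \<open>x\<close> runs
  through the binary digit sequences of the points \<open>y\<close> of \<open>[0, 1]\<close> and \<open>a x + \<xi> * b x = y\<close>. Then
  \<open>A + \<xi> A\<close> contains the unit interval, and as a group it is all of the line. The question is how to
  distribute the digits of \<open>y\<close> over \<open>a x\<close> and \<open>b x\<close> without increasing the dimension. Giving some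
  digits to \<open>a x\<close> and the others to \<open>b x\<close> does not work: the integer combinations of \<open>a x\<close> and
  \<open>b x\<close> also lie in \<open>A\<close>, and \<open>a x + b x\<close> would see all the digits.

  Instead, the digits are cut into blocks, the \<open>n\<close>-th one consisting of the positions from \<open>k n\<close> to
  \<open>k (n + 1)\<close>, and the digits of block \<open>n\<close> enter \<open>a x\<close> with a weight \<open>u\<close> and \<open>b x\<close> with a weight
  \<open>v\<close> subject only to \<open>u + \<xi> v = 1\<close>. Because \<open>\<xi>\<close> is irrational, for every pair of integers
  \<open>(p, q) \<noteq> (0, 0)\<close> there is such a pair of weights with \<open>p u + q v = 0\<close>; with these weights
  block \<open>n\<close> disappears from \<open>p * a x + q * b x\<close>. The weights may moreover depend on the digits of \<open>x\<close>
  before the block. This matters for combinations of several points: an element of \<open>A\<close> is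
  \<open>b\<close> plus a sum of \<open>p x * a x + q x * b x\<close> over a finite set \<open>F\<close> of digit sequences, and
  since the elements of \<open>F\<close> differ within their first \<open>l\<close> digits for some \<open>l\<close>, the coefficients
  \<open>(p x, q x)\<close> can be written as a function \<open>g\<close> of these digits. There are only countably many such
  \<open>g\<close>, so every one of them can be annihilated in infinitely many blocks
  (lemma \<open>annihilating_weights\<close>).

  In a block \<open>n\<close> that annihilates \<open>g\<close>, the sums belonging to \<open>g\<close> are determined by the digits before
  \<open>k n\<close> up to an error governed by the digits after \<open>k (n + 1)\<close>: they lie very close to a finite set
  whose size is bounded in terms of \<open>k n\<close> (lemma \<open>block_sums_near_finite_set\<close>). So \<open>k (n + 1)\<close>
  is chosen last. Given \<open>k n\<close>, cover \<open>K n\<close> by finitely many intervals whose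
  \<open>(d + 1/(n + 1))\<close>-th powers of lengths have an extremely small sum, and then take \<open>k (n + 1)\<close>
  so large that the error is below the shortest of these intervals. Translating the
  enlarged intervals by the finite set covers \<open>K n\<close> plus all sums belonging to \<open>g\<close>
  (lemmas \<open>sumset_ball_cover_scale\<close> and \<open>block_scales_exist\<close>). As this happens for infinitely
  many \<open>n\<close>, the part of \<open>A\<close> that belongs to \<open>g\<close> is null in every dimension above \<open>d\<close>, and \<open>A\<close> is a
  countable union of such parts (lemma \<open>hausdorff_null_generated_sums\<close>).

  Finally, \<open>a\<close> and \<open>b\<close> are continuous on the compact space of digit sequences, so \<open>A\<close> is a
  countable union of compact sets.
\<close>

section \<open>Null sets for Hausdorff measures\<close>

text \<open>Radius \<open>0\<close> is allowed: such a ball is empty and contributes \<open>0 powr s = 0\<close>, so finite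
  covers are included.\<close>
definition ball_cover :: "real \<Rightarrow> real \<Rightarrow> real set \<Rightarrow> bool" where
  "ball_cover s \<eta> X \<longleftrightarrow>
     (\<exists>c r. (\<forall>i::nat. 0 \<le> r i) \<and> X \<subseteq> (\<Union>i. ball (c i) (r i)) \<and>
            (\<Sum>i. ennreal (r i powr s)) \<le> ennreal \<eta>)"

definition hausdorff_null :: "real \<Rightarrow> real set \<Rightarrow> bool" where
  "hausdorff_null s X \<longleftrightarrow> (\<forall>\<eta>>0. ball_cover s \<eta> X)"

lemma ball_coverI:
  assumes "\<And>i::nat. 0 \<le> r i" "X \<subseteq> (\<Union>i. ball (c i) (r i))"
    and "(\<Sum>i. ennreal (r i powr s)) \<le> ennreal \<eta>"
  shows "ball_cover s \<eta> X"
  using assms unfolding ball_cover_def by blast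

lemma ball_coverE:
  assumes "ball_cover s \<eta> X"
  obtains c r where "\<And>i::nat. 0 \<le> r i" "X \<subseteq> (\<Union>i. ball (c i) (r i))"
    "(\<Sum>i. ennreal (r i powr s)) \<le> ennreal \<eta>"
  using assms unfolding ball_cover_def by blast

lemma ball_cover_mono: "ball_cover s \<eta> X \<Longrightarrow> Y \<subseteq> X \<Longrightarrow> \<eta> \<le> \<eta>' \<Longrightarrow> ball_cover s \<eta>' Y"
  unfolding ball_cover_def by (meson ennreal_leI order_trans)

lemma hausdorff_null_subset: "hausdorff_null s X \<Longrightarrow> Y \<subseteq> X \<Longrightarrow> hausdorff_null s Y"
  unfolding hausdorff_null_def by (meson ball_cover_mono order_refl)

lemma ennreal_term_le_suminf: "f i \<le> (\<Sum>i. f i)" for f :: "nat \<Rightarrow> ennreal"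
  using sum_le_suminf[of f "{i}"] by simp

text \<open>If the total is at most \<open>1\<close> then every radius is at most \<open>1\<close>, and raising the exponent only
  decreases the powers.\<close>
lemma ball_cover_exponent_mono:
  assumes "ball_cover s \<eta> X" "\<eta> \<le> 1" "0 < s" "s \<le> t"
  shows "ball_cover t \<eta> X"
proof -
  obtain c r where r: "\<And>i::nat. 0 \<le> r i" and X: "X \<subseteq> (\<Union>i. ball (c i) (r i))"
    and sum: "(\<Sum>i. ennreal (r i powr s)) \<le> ennreal \<eta>"
    using assms(1) by (rule ball_coverE) blast
  have "r i powr t \<le> r i powr s" for i
  proof -
    have "ennreal (r i powr s) \<le> ennreal \<eta>"
      using ennreal_term_le_suminf[of "\<lambda>i. ennreal (r i powr s)"] sum by (rule order_trans)
    also have "\<dots> \<le> ennreal 1"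
      using \<open>\<eta> \<le> 1\<close> by (rule ennreal_leI)
    finally have "r i powr s \<le> 1"
      by (subst (asm) ennreal_le_iff) auto
    then have "r i \<le> 1"
      using \<open>0 < s\<close> gr_one_powr[of "r i" s] by linarith
    then show ?thesis
      using r[of i] \<open>s \<le> t\<close> by (intro powr_mono') auto
  qed
  then have "(\<Sum>i. ennreal (r i powr t)) \<le> (\<Sum>i. ennreal (r i powr s))"
    by (intro suminf_le) (auto intro: ennreal_leI)
  then show ?thesis
    using r X sum by (intro ball_coverI[of r X c]) auto
qed

lemma ball_cover_finite:
  assumes "finite J" "\<And>j. j \<in> J \<Longrightarrow> 0 \<le> r j" "X \<subseteq> (\<Union>j\<in>J. ball (c j) (r j))"
    and "(\<Sum>j\<in>J. r j powr s) \<le> \<eta>"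
  shows "ball_cover s \<eta> X"
proof -
  obtain h where h: "bij_betw h {0..<card J} J"
    using ex_bij_betw_nat_finite[OF assms(1)] by blast
  define R where "R i = (if i < card J then r (h i) else 0)" for i
  have hJ: "h i \<in> J" if "i < card J" for i
    using h that by (auto simp: bij_betw_def)
  have "(\<Sum>i. ennreal (R i powr s)) = (\<Sum>i<card J. ennreal (R i powr s))"
    by (rule suminf_finite) (auto simp: R_def)
  also have "\<dots> = ennreal (\<Sum>i<card J. r (h i) powr s)"
    by (simp add: R_def)
  also have "(\<Sum>i<card J. r (h i) powr s) = (\<Sum>j\<in>J. r j powr s)"
    using sum.reindex_bij_betw[OF h, of "\<lambda>j. r j powr s"] by (simp add: atLeast0LessThan)
  finally have "(\<Sum>i. ennreal (R i powr s)) \<le> ennreal \<eta>"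
    using assms(4) by (simp add: ennreal_leI)
  moreover have "X \<subseteq> (\<Union>i. ball (c (h i)) (R i))"
  proof
    fix x assume "x \<in> X"
    then obtain j where "j \<in> J" "x \<in> ball (c j) (r j)" using assms(3) by blast
    moreover obtain i where "i < card J" "h i = j"
      using h \<open>j \<in> J\<close> unfolding bij_betw_def by (metis imageE atLeastLessThan_iff)
    ultimately show "x \<in> (\<Union>i. ball (c (h i)) (R i))"
      by (auto simp: R_def intro!: exI[of _ i])
  qed
  ultimately show ?thesis
    using hJ assms(2) by (intro ball_coverI[of R X "\<lambda>i. c (h i)"]) (auto simp: R_def)
qed

lemma suminf_ennreal_geometric:
  assumes "0 \<le> \<eta>"
  shows "(\<Sum>i. ennreal (\<eta> / 2 ^ Suc i)) = ennreal \<eta>"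
proof -
  have "(\<lambda>i. \<eta> * (1 / 2) ^ Suc i) sums (\<eta> * 1)"
    by (intro sums_mult power_half_series)
  then have "(\<lambda>i. \<eta> / 2 ^ Suc i) sums \<eta>"
    by (simp add: power_divide)
  then show ?thesis
    using assms by (intro suminf_ennreal_eq) auto
qed

lemma hausdorff_null_UN:
  assumes "\<And>m::nat. hausdorff_null s (X m)"
  shows "hausdorff_null s (\<Union>m. X m)"
  unfolding hausdorff_null_def
proof (intro allI impI)
  fix \<eta> :: real assume "0 < \<eta>"
  then have "ball_cover s (\<eta> / 2 ^ Suc m) (X m)" for m
    using assms[of m] by (auto simp: hausdorff_null_def)
  then obtain c r where r: "\<And>m i::nat. 0 \<le> r m i" and X: "\<And>m. X m \<subseteq> (\<Union>i. ball (c m i) (r m i))"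
    and sum: "\<And>m. (\<Sum>i. ennreal (r m i powr s)) \<le> ennreal (\<eta> / 2 ^ Suc m)"
    unfolding ball_cover_def by metis
  define f where "f p = ennreal (r (fst p) (snd p) powr s)" for p
  have "(\<Sum>i. f (prod_decode i)) = (\<Sum>m. \<Sum>i. f (m, i))"
    by (rule suminf_ennreal_2dimen) simp
  also have "\<dots> \<le> (\<Sum>m. ennreal (\<eta> / 2 ^ Suc m))"
    using sum by (intro suminf_le) (auto simp: f_def)
  also have "\<dots> = ennreal \<eta>"
    using \<open>0 < \<eta>\<close> by (intro suminf_ennreal_geometric) simp
  finally have le: "(\<Sum>i. ennreal (r (fst (prod_decode i)) (snd (prod_decode i)) powr s)) \<le> ennreal \<eta>"
    by (simp add: f_def)
  show "ball_cover s \<eta> (\<Union>m. X m)"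
  proof (rule ball_coverI[OF _ _ le])
    show "(\<Union>m. X m) \<subseteq> (\<Union>i. ball (c (fst (prod_decode i)) (snd (prod_decode i)))
                                  (r (fst (prod_decode i)) (snd (prod_decode i))))"
    proof clarify
      fix x m assume "x \<in> X m"
      then obtain i where "x \<in> ball (c m i) (r m i)" using X by blast
      then show "x \<in> (\<Union>i. ball (c (fst (prod_decode i)) (snd (prod_decode i)))
                                  (r (fst (prod_decode i)) (snd (prod_decode i))))"
        by (intro UN_I[of "prod_encode (m, i)"]) auto
    qed
  qed (rule r)
qed

lemma hausdorff_null_countable_UN:
  assumes "countable I" "\<And>i. i \<in> I \<Longrightarrow> hausdorff_null s (X i)"
  shows "hausdorff_null s (\<Union>i\<in>I. X i)"
proof (cases "I = {}")
  case True
  have "ball_cover s \<eta> {}" if "0 < \<eta>" for \<eta>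
    by (rule ball_cover_finite[where J = "{} :: nat set"]) (use that in auto)
  then show ?thesis using True by (simp add: hausdorff_null_def)
next
  case False
  have "hausdorff_null s (\<Union>m. X (from_nat_into I m))"
    using assms(2) from_nat_into[OF False] by (intro hausdorff_null_UN) blast
  moreover have "(\<Union>m. X (from_nat_into I m)) = (\<Union>i\<in>I. X i)"
    using range_from_nat_into[OF False assms(1)] by (metis image_image)
  ultimately show ?thesis by simp
qed

text \<open>Requiring the sum of the \<open>s\<close>-th powers of the radii to be small forces every single radius to be
  small, so no separate bound on the diameters has to be imposed.\<close>
lemma hausdorff_null_imp_outer_measure_0:
  assumes "hausdorff_null s X" "0 < s"
  shows "hausdorff_outer_measure s X = 0"
proof -
  have "hausdorff_premeasure s \<delta> X \<le> ennreal e" if "\<delta> > 0" "e > 0" for \<delta> e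
  proof -
    define \<eta> where "\<eta> = min (e / 2 powr s) ((\<delta> / 2) powr s)"
    have "\<eta> > 0" using that by (simp add: \<eta>_def)
    then have "ball_cover s \<eta> X" using assms(1) by (simp add: hausdorff_null_def)
    then obtain c r where r: "\<And>i::nat. 0 \<le> r i" and X: "X \<subseteq> (\<Union>i. ball (c i) (r i))"
      and sum: "(\<Sum>i. ennreal (r i powr s)) \<le> ennreal \<eta>"
      by (rule ball_coverE) blast
    have small: "r i \<le> \<delta> / 2" for i
    proof (rule ccontr)
      assume "\<not> r i \<le> \<delta> / 2"
      then have "(\<delta> / 2) powr s < r i powr s"
        using that \<open>0 < s\<close> by (intro powr_less_mono2) auto
      moreover have "ennreal (r i powr s) \<le> ennreal \<eta>"
        using ennreal_term_le_suminf[of "\<lambda>i. ennreal (r i powr s)"] sum by (rule order_trans)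
      then have "r i powr s \<le> \<eta>"
        using \<open>\<eta> > 0\<close> by simp
      ultimately show False by (simp add: \<eta>_def)
    qed
    have "hausdorff_premeasure s \<delta> X \<le> (\<Sum>i. diam_power s (ball (c i) (r i)))"
      unfolding hausdorff_premeasure_def
      using X r small that by (intro INF_lower) (auto simp: diameter_ball field_simps not_less)
    also have "\<dots> \<le> (\<Sum>i. ennreal (2 powr s) * ennreal (r i powr s))"
      using \<open>0 < s\<close> r by (intro suminf_le)
        (auto simp: diam_power_def diameter_ball powr_mult not_less ennreal_mult'[symmetric] intro!: ennreal_leI)
    also have "\<dots> = ennreal (2 powr s) * (\<Sum>i. ennreal (r i powr s))"
      by simp
    also have "\<dots> \<le> ennreal (2 powr s) * ennreal \<eta>"
      using sum by (rule mult_left_mono) simp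
    also have "\<dots> = ennreal (2 powr s * \<eta>)"
      by (simp add: ennreal_mult')
    also have "\<dots> \<le> ennreal e"
      by (intro ennreal_leI) (simp add: \<eta>_def min_def field_simps)
    finally show ?thesis .
  qed
  then have "hausdorff_premeasure s \<delta> X = 0" if "\<delta> > 0" for \<delta>
    using that by (metis ennreal_le_epsilon add_0 le_zero_eq)
  then show ?thesis
    unfolding hausdorff_outer_measure_def by (simp add: SUP_eq_iff bot_ennreal)
qed

text \<open>Each covering set is replaced by a ball around one of its points. Its radius has to exceed the
  diameter even when the diameter is \<open>0\<close>; the maximum with \<open>w i\<close> takes care of this at a total
  cost of \<open>\<eta> / 2\<close>. The exponent \<open>s = 0\<close> is included: every nonempty
  covering set then contributes \<open>1\<close>, which dominates the \<open>t\<close>-th power of a diameter below \<open>1\<close>.\<close>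
lemma outer_measure_0_imp_hausdorff_null:
  assumes "hausdorff_outer_measure s X = 0" "0 \<le> s" "s \<le> t" "0 < t"
  shows "hausdorff_null t X"
  unfolding hausdorff_null_def
proof (intro allI impI)
  fix \<eta> :: real assume "0 < \<eta>"
  have "hausdorff_premeasure s 1 X \<le> hausdorff_outer_measure s X"
    unfolding hausdorff_outer_measure_def by (rule SUP_upper) simp
  then have "hausdorff_premeasure s 1 X < ennreal (\<eta> / 2 / 2 powr t)"
    using assms(1) \<open>0 < \<eta>\<close> by simp
  then obtain U :: "nat \<Rightarrow> real set" where X: "X \<subseteq> (\<Union>i. U i)"
    and U: "\<And>i. bounded (U i)" "\<And>i. diameter (U i) \<le> 1"
    and sum: "(\<Sum>i. diam_power s (U i)) < ennreal (\<eta> / 2 / 2 powr t)"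
    unfolding hausdorff_premeasure_def INF_less_iff by auto
  define w where "w i = (\<eta> / 2 / 2 ^ Suc i) powr (1 / t)" for i :: nat
  define r where "r i = (if U i = {} then 0 else max (2 * diameter (U i)) (w i))" for i
  define c where "c i = (SOME x. x \<in> U i)" for i
  have w: "w i > 0" "w i powr t = \<eta> / 2 / 2 ^ Suc i" for i
    using \<open>0 < \<eta>\<close> \<open>0 < t\<close> by (auto simp: w_def powr_powr)
  have r0: "0 \<le> r i" for i
    using w(1)[of i] by (auto simp: r_def)
  have "U i \<subseteq> ball (c i) (r i)" for i
  proof
    fix x assume x: "x \<in> U i"
    then have c: "c i \<in> U i" unfolding c_def by (rule someI)
    have "dist (c i) x \<le> diameter (U i)"
      using U(1) c x by (rule diameter_bounded_bound)
    moreover have "0 \<le> diameter (U i)" using U(1) by (rule diameter_ge_0)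
    ultimately show "x \<in> ball (c i) (r i)"
      using w(1)[of i] x by (auto simp: r_def)
  qed
  then have XU: "X \<subseteq> (\<Union>i. ball (c i) (r i))"
    by (intro order_trans[OF X] UN_mono) auto
  have term_le: "ennreal (r i powr t) \<le> ennreal (2 powr t) * diam_power s (U i) + ennreal (\<eta> / 2 / 2 ^ Suc i)" for i
  proof (cases "U i = {}")
    case False
    define D where "D = diameter (U i)"
    have D: "0 \<le> D" "D \<le> 1" unfolding D_def using U by (auto intro: diameter_ge_0)
    have "r i powr t \<le> (2 * D) powr t + w i powr t"
    proof (cases "2 * D \<le> w i")
      case True
      then have "r i = w i" using False by (simp add: r_def D_def)
      then show ?thesis by simp
    next
      case F: False
      then have "r i = 2 * D" using False by (simp add: r_def D_def)
      then show ?thesis by simp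
    qed
    also have "\<dots> = 2 powr t * D powr t + \<eta> / 2 / 2 ^ Suc i"
      using D by (simp add: w(2) powr_mult)
    finally have "ennreal (r i powr t) \<le> ennreal (2 powr t * D powr t + \<eta> / 2 / 2 ^ Suc i)"
      by (rule ennreal_leI)
    also have "\<dots> = ennreal (2 powr t) * ennreal (D powr t) + ennreal (\<eta> / 2 / 2 ^ Suc i)"
      using \<open>0 < \<eta>\<close> by (subst ennreal_plus) (auto simp: ennreal_mult')
    also have "\<dots> \<le> ennreal (2 powr t) * diam_power s (U i) + ennreal (\<eta> / 2 / 2 ^ Suc i)"
    proof (intro add_right_mono mult_left_mono)
      have "D powr t \<le> 1" using D \<open>0 < t\<close> by (simp add: powr_le1)
      moreover have "D powr t \<le> D powr s" using D \<open>s \<le> t\<close> by (intro powr_mono') auto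
      ultimately show "ennreal (D powr t) \<le> diam_power s (U i)"
        using False by (auto simp: diam_power_def D_def intro: ennreal_leI simp flip: ennreal_1)
    qed simp
    finally show ?thesis .
  qed (simp add: r_def)
  have "(\<Sum>i. ennreal (r i powr t))
      \<le> (\<Sum>i. ennreal (2 powr t) * diam_power s (U i) + ennreal (\<eta> / 2 / 2 ^ Suc i))"
    using term_le by (intro suminf_le) auto
  also have "\<dots> = ennreal (2 powr t) * (\<Sum>i. diam_power s (U i)) + (\<Sum>i. ennreal (\<eta> / 2 / 2 ^ Suc i))"
    by (simp add: suminf_add[symmetric])
  also have "\<dots> \<le> ennreal (2 powr t) * ennreal (\<eta> / 2 / 2 powr t) + ennreal (\<eta> / 2)"
  proof (rule add_mono)
    show "ennreal (2 powr t) * (\<Sum>i. diam_power s (U i)) \<le> ennreal (2 powr t) * ennreal (\<eta> / 2 / 2 powr t)"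
      using sum by (intro mult_left_mono) (rule less_imp_le, simp_all)
    show "(\<Sum>i. ennreal (\<eta> / 2 / 2 ^ Suc i)) \<le> ennreal (\<eta> / 2)"
      using \<open>0 < \<eta>\<close> by (subst suminf_ennreal_geometric) simp_all
  qed
  also have "\<dots> = ennreal (2 powr t * (\<eta> / 2 / 2 powr t) + \<eta> / 2)"
    using \<open>0 < \<eta>\<close> by (subst ennreal_plus) (simp_all add: ennreal_mult'[symmetric])
  also have "2 powr t * (\<eta> / 2 / 2 powr t) + \<eta> / 2 = \<eta>"
    by simp
  finally show "ball_cover t \<eta> X"
    by (rule ball_coverI[OF r0 XU])
qed

lemma hausdorff_dim_mono:
  fixes A B :: "real set"
  assumes "B \<subseteq> A"
  shows "hausdorff_dim B \<le> hausdorff_dim A"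
proof -
  have "hausdorff_premeasure s \<delta> B \<le> hausdorff_premeasure s \<delta> A" for s \<delta>
    unfolding hausdorff_premeasure_def using assms by (intro INF_superset_mono) auto
  then have "hausdorff_outer_measure s B \<le> hausdorff_outer_measure s A" for s
    unfolding hausdorff_outer_measure_def by (intro SUP_mono) auto
  then have "{s. 0 \<le> s \<and> hausdorff_outer_measure s A = 0} \<subseteq> {s. 0 \<le> s \<and> hausdorff_outer_measure s B = 0}"
    by (smt (verit, ccfv_threshold) Collect_mono le_zero_eq)
  then show ?thesis
    unfolding hausdorff_dim_def by (rule INF_superset_mono) (rule order_refl)
qed

lemma hausdorff_null_above_dim:
  assumes "hausdorff_dim X < ennreal t" 
  shows "hausdorff_null t X"
proof -
  obtain s where "0 \<le> s" "hausdorff_outer_measure s X = 0" "ennreal s < ennreal t"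
    using assms unfolding hausdorff_dim_def INF_less_iff by auto
  then show ?thesis
    by (intro outer_measure_0_imp_hausdorff_null[of s]) (auto simp: ennreal_less_iff)
qed

lemma hausdorff_dim_le:
  assumes "0 \<le> d" "\<And>t. d < t \<Longrightarrow> hausdorff_null t X"
  shows "hausdorff_dim X \<le> ennreal d"
proof (rule ennreal_le_epsilon)
  fix e :: real assume "0 < e"
  then have "hausdorff_outer_measure (d + e) X = 0"
    using assms by (intro hausdorff_null_imp_outer_measure_0) auto
  then have "hausdorff_dim X \<le> ennreal (d + e)"
    unfolding hausdorff_dim_def using assms(1) \<open>0 < e\<close> by (intro INF_lower) auto
  then show "hausdorff_dim X \<le> ennreal d + ennreal e"
    using assms(1) \<open>0 < e\<close> by simp
qed

section \<open>Functions of finitely many digits\<close>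

text \<open>Prefixes of length \<open>l\<close> are represented by infinite sequences padded with \<open>False\<close>, so that a
  function of sequences can be applied to a prefix as well.\<close>
definition trunc :: "nat \<Rightarrow> (nat \<Rightarrow> bool) \<Rightarrow> (nat \<Rightarrow> bool)" where
  "trunc l x = (\<lambda>i. i < l \<and> x i)"

lemma trunc_trunc: "trunc l (trunc m x) = trunc (min l m) x"
  by (auto simp: trunc_def)

lemma card_range_trunc: "finite (range (trunc l))" "card (range (trunc l)) \<le> 2 ^ l"
proof -
  have "range (trunc l) \<subseteq> (\<lambda>S i. i \<in> S) ` Pow {..<l}"
  proof clarify
    fix x show "trunc l x \<in> (\<lambda>S i. i \<in> S) ` Pow {..<l}"
      by (rule image_eqI[of _ _ "{i. i < l \<and> x i}"]) (auto simp: trunc_def)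
  qed
  then show "finite (range (trunc l))" "card (range (trunc l)) \<le> 2 ^ l"
    using surj_card_le[of "Pow {..<l}" "range (trunc l)"]
    by (auto simp: card_Pow intro: finite_subset[OF _ finite_imageI])
qed

text \<open>As \<open>trunc l\<close> is idempotent, this equation says that \<open>g\<close> factors through the first \<open>l\<close> digits.\<close>
definition determined :: "nat \<Rightarrow> ((nat \<Rightarrow> bool) \<Rightarrow> 'b) \<Rightarrow> bool" where
  "determined l g \<longleftrightarrow> (\<forall>x. g (trunc l x) = g x)"

lemma determinedD: "determined l g \<Longrightarrow> g (trunc l x) = g x"
  by (simp add: determined_def)

lemma determined_mono:
  assumes "determined l g" "l \<le> m"
  shows "determined m g"
proof -
  have "g (trunc m x) = g x" for x
    using assms determinedD[OF assms(1), of x] determinedD[OF assms(1), of "trunc m x"]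
    by (simp add: trunc_trunc min_absorb1)
  then show ?thesis by (simp add: determined_def)
qed

lemma determined_finite_range:
  assumes "determined l g"
  shows "finite (range g)"
proof -
  have "range g \<subseteq> g ` range (trunc l)"
    using determinedD[OF assms] by (metis image_subsetI rangeI image_eqI)
  then show ?thesis
    using card_range_trunc(1) finite_subset by blast
qed

text \<open>Such a function is given by its values on the finite set of truncated sequences.\<close>
lemma countable_determined:
  "countable {g :: (nat \<Rightarrow> bool) \<Rightarrow> 'b::countable. \<exists>l. determined l g}"
proof -
  have "countable {g :: (nat \<Rightarrow> bool) \<Rightarrow> 'b. determined l g}" for l
  proof (rule countable_image_inj_on)
    show "countable ((\<lambda>g. restrict g (range (trunc l))) ` {g :: (nat \<Rightarrow> bool) \<Rightarrow> 'b. determined l g})"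
    proof (rule countable_subset)
      show "countable (PiE (range (trunc l)) (\<lambda>_. UNIV :: 'b set))"
        by (intro countable_PiE card_range_trunc) auto
    qed auto
    show "inj_on (\<lambda>g. restrict g (range (trunc l))) {g :: (nat \<Rightarrow> bool) \<Rightarrow> 'b. determined l g}"
    proof (rule inj_onI)
      fix g h :: "(nat \<Rightarrow> bool) \<Rightarrow> 'b"
      assume g: "g \<in> {g. determined l g}" and h: "h \<in> {g. determined l g}"
        and eq: "restrict g (range (trunc l)) = restrict h (range (trunc l))"
      show "g = h"
      proof
        fix x
        have "g (trunc l x) = h (trunc l x)"
          using fun_cong[OF eq, of "trunc l x"] by simp
        then show "g x = h x"
          using g h by (simp add: determined_def)
      qed
    qed
  qed
  then have "countable (\<Union>l. {g :: (nat \<Rightarrow> bool) \<Rightarrow> 'b. determined l g})"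
    by (intro countable_UN) auto
  then show ?thesis
    by (rule countable_subset[rotated]) auto
qed

lemma finite_separating_level:
  assumes "finite F"
  shows "\<exists>l. inj_on (trunc l) F"
proof -
  have "\<exists>i. x \<noteq> y \<longrightarrow> x i \<noteq> y i" for x y :: "nat \<Rightarrow> bool"
    by (auto simp: fun_eq_iff)
  then obtain d where d: "\<And>x y :: nat \<Rightarrow> bool. x \<noteq> y \<Longrightarrow> x (d x y) \<noteq> y (d x y)"
    by metis
  define l where "l = Suc (Max ((\<lambda>(x, y). d x y) ` (F \<times> F)))"
  have "inj_on (trunc l) F"
  proof (rule inj_onI, rule ccontr)
    fix x y assume xy: "x \<in> F" "y \<in> F" "trunc l x = trunc l y" "x \<noteq> y"
    have "d x y \<le> Max ((\<lambda>(x, y). d x y) ` (F \<times> F))"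
      using assms xy by (intro Max_ge) auto
    then have "d x y < l" by (simp add: l_def)
    then have "x (d x y) = y (d x y)"
      using fun_cong[OF xy(3), of "d x y"] by (simp add: trunc_def)
    then show False using d xy(4) by blast
  qed
  then show ?thesis ..
qed

lemma determined_interpolation:
  assumes "inj_on (trunc l) F"
  shows "\<exists>g. determined l g \<and> (\<forall>x\<in>F. g x = h x)"
proof (intro exI conjI ballI)
  define g where "g x = h (the_inv_into F (trunc l) (trunc l x))" for x
  show "determined l g"
    by (simp add: determined_def g_def trunc_trunc)
  show "g x = h x" if "x \<in> F" for x
    using assms that by (simp add: g_def the_inv_into_f_f)
qed

lemma open_trunc_fibre: "open {x. trunc l x = trunc l y}"
proof -
  have "{x. trunc l x = trunc l y} = (\<Inter>i<l. {x. x i = y i})"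
    by (auto simp: trunc_def fun_eq_iff)
  moreover have "open {x :: nat \<Rightarrow> bool. x i = y i}" for i
  proof -
    have "open ((\<lambda>x :: nat \<Rightarrow> bool. x i) -` {y i})"
      by (intro open_vimage open_discrete continuous_on_product_coordinates)
    then show ?thesis by (simp add: vimage_def)
  qed
  ultimately show ?thesis by (simp add: open_INT)
qed

text \<open>The level sets of such a function are open, being unions of fibres of \<open>trunc l\<close>.\<close>
lemma determined_imp_continuous:
  fixes f :: "(nat \<Rightarrow> bool) \<Rightarrow> 'b::topological_space"
  assumes "determined l f"
  shows "continuous_on UNIV f"
proof -
  have "open (f -` S)" for S
  proof -
    have "f -` S = (\<Union>y\<in>f -` S. {x. trunc l x = trunc l y})"
      using assms by (auto simp: determined_def) metis
    then show ?thesis by (metis (no_types, lifting) open_UN open_trunc_fibre)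
  qed
  then show ?thesis by (simp add: continuous_on_open_vimage)
qed

lemma compact_Cantor_space: "compact (UNIV :: (nat \<Rightarrow> bool) set)"
proof -
  have "compact_space (product_topology (\<lambda>_. euclidean) (UNIV :: nat set) :: (nat \<Rightarrow> bool) topology)"
    unfolding compact_space_product_topology
    by (auto simp: compact_space_def finite_imp_compact)
  then show ?thesis
    by (simp add: euclidean_product_topology compact_space_def)
qed

section \<open>Weights that annihilate integer combinations\<close>

text \<open>For integers \<open>(p, q) \<noteq> (0, 0)\<close> the equations \<open>u + \<xi> v = 1\<close> and \<open>p u + q v = 0\<close> have the solution
  \<open>u = q / (q - \<xi> p)\<close>, \<open>v = - p / (q - \<xi> p)\<close>, the denominator being nonzero because \<open>\<xi>\<close> is
  irrational. All coefficient functions \<open>g\<close> are enumerated, and the pair coding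
  of the naturals lets each of them come up infinitely often. The \<open>n\<close>-th weights serve the
  scheduled function only once \<open>n\<close> is large enough for the dependence on digits and for
  the size of the weights, and are \<open>(1, 0)\<close> otherwise; the bound \<open>n + 1\<close> guarantees that
  the weighted digit series converge whatever the schedule is.\<close>
lemma annihilating_weights:
  fixes \<xi> :: real
  assumes "\<xi> \<notin> \<rat>"
  obtains u v :: "nat \<Rightarrow> (nat \<Rightarrow> bool) \<Rightarrow> real" where
    "\<And>n. determined n (u n)" "\<And>n. determined n (v n)"
    "\<And>n x. \<bar>u n x\<bar> \<le> real n + 1" "\<And>n x. \<bar>v n x\<bar> \<le> real n + 1"
    "\<And>n x. u n x + \<xi> * v n x = 1"
    "\<And>l (g :: (nat \<Rightarrow> bool) \<Rightarrow> int \<times> int) N. determined l g \<Longrightarrow>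
       \<exists>n\<ge>N. \<forall>x. of_int (fst (g x)) * u n x + of_int (snd (g x)) * v n x = 0"
proof -
  define U V :: "int \<times> int \<Rightarrow> real" where
    "U c = (if c = 0 then 1 else of_int (snd c) / (of_int (snd c) - \<xi> * of_int (fst c)))" and
    "V c = (if c = 0 then 0 else - of_int (fst c) / (of_int (snd c) - \<xi> * of_int (fst c)))" for c
  have nz: "of_int q - \<xi> * of_int p \<noteq> 0" if "(p, q) \<noteq> 0" for p q :: int
  proof
    assume eq: "of_int q - \<xi> * of_int p = 0"
    show False
    proof (cases "p = 0")
      case True
      then show False using eq that by (simp add: zero_prod_def)
    next
      case False
      then have "\<xi> = of_int q / of_int p" using eq by (simp add: field_simps)
      then show False using assms by simp
    qed
  qed
  have UV1: "U c + \<xi> * V c = 1" for c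
  proof (cases c)
    case (Pair p q)
    then show ?thesis using nz[of p q]
      by (cases "c = 0") (auto simp: U_def V_def diff_divide_distrib[symmetric])
  qed
  have UV0: "of_int (fst c) * U c + of_int (snd c) * V c = 0" for c
    by (cases "c = 0") (auto simp: U_def V_def zero_prod_def)
  define G :: "nat \<Rightarrow> (nat \<Rightarrow> bool) \<Rightarrow> int \<times> int" where "G = from_nat_into {g. \<exists>l. determined l g}"
  define D where "D n = G (fst (prod_decode n))" for n
  define ok where "ok n \<longleftrightarrow> determined n (D n) \<and> (\<forall>x. \<bar>U (D n x)\<bar> \<le> real n + 1 \<and> \<bar>V (D n x)\<bar> \<le> real n + 1)" for n
  define u where "u n x = (if ok n then U (D n x) else 1)" for n x
  define v where "v n x = (if ok n then V (D n x) else 0)" for n x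
  show thesis
  proof (rule that)
    show "determined n (u n)" "determined n (v n)" for n
      by (auto simp: determined_def u_def v_def ok_def)
    show "\<bar>u n x\<bar> \<le> real n + 1" "\<bar>v n x\<bar> \<le> real n + 1" for n x
      by (auto simp: u_def v_def ok_def)
    show "u n x + \<xi> * v n x = 1" for n x
      using UV1 by (simp add: u_def v_def)
    fix l N :: nat and g :: "(nat \<Rightarrow> bool) \<Rightarrow> int \<times> int"
    assume g: "determined l g"
    then obtain m where m: "G m = g"
      unfolding G_def using from_nat_into_surj[OF countable_determined] by blast
    have "finite ((\<lambda>c. max \<bar>U c\<bar> \<bar>V c\<bar>) ` range g)"
      using determined_finite_range[OF g] by simp
    then obtain M where M: "\<And>x. max \<bar>U (g x)\<bar> \<bar>V (g x)\<bar> \<le> M"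
      by (meson bdd_above_finite bdd_above.E image_eqI rangeI)
    define j where "j = max N (max l (nat \<lceil>M\<rceil>))"
    define n where "n = prod_encode (m, j)"
    have n: "j \<le> n" unfolding n_def by (rule le_prod_encode_2)
    have "D n = g" by (simp add: D_def n_def m)
    moreover have "M \<le> real n + 1"
      using n unfolding j_def by linarith
    ultimately have "ok n"
      using M n determined_mono[OF g, of n] unfolding ok_def j_def
      by (metis max.bounded_iff max.cobounded1 order_trans)
    then have "\<forall>x. of_int (fst (g x)) * u n x + of_int (snd (g x)) * v n x = 0"
      using UV0 \<open>D n = g\<close> by (simp add: u_def v_def)
    then show "\<exists>n\<ge>N. \<forall>x. of_int (fst (g x)) * u n x + of_int (snd (g x)) * v n x = 0"
      using n unfolding j_def by auto
  qed
qed

section \<open>Binary series with blockwise weights\<close>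

text \<open>Block \<open>n\<close> ends before position \<open>k (Suc n)\<close>; positions before \<open>k 0\<close> are counted to block \<open>0\<close>.\<close>
definition stage :: "(nat \<Rightarrow> nat) \<Rightarrow> nat \<Rightarrow> nat" where
  "stage k i = (LEAST n. i < k (Suc n))"

lemma less_stage_Suc:
  assumes "strict_mono k"
  shows "i < k (Suc (stage k i))"
  unfolding stage_def
proof (rule LeastI[of "\<lambda>n. i < k (Suc n)"])
  show "i < k (Suc i)"
    using strict_mono_imp_increasing[OF assms, of "Suc i"] by simp
qed

lemma stage_le: "i < k (Suc n) \<Longrightarrow> stage k i \<le> n"
  unfolding stage_def by (rule Least_le)

lemma stage_le_index: "strict_mono k \<Longrightarrow> stage k i \<le> i"
  using strict_mono_imp_increasing[of k "Suc i"] by (intro stage_le) simp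

lemma stage_eq:
  assumes "strict_mono k" "k n \<le> i" "i < k (Suc n)"
  shows "stage k i = n"
proof (rule antisym)
  have "k n < k (Suc (stage k i))"
    using less_stage_Suc[OF assms(1), of i] assms(2) by simp
  then show "n \<le> stage k i"
    using assms(1) by (simp add: strict_mono_less)
  show "stage k i \<le> n" using assms(3) by (rule stage_le)
qed

definition block_term :: "(nat \<Rightarrow> nat) \<Rightarrow> (nat \<Rightarrow> (nat \<Rightarrow> bool) \<Rightarrow> real) \<Rightarrow> (nat \<Rightarrow> bool) \<Rightarrow> nat \<Rightarrow> real" where
  "block_term k w x i = w (stage k i) x * (of_bool (x i) / 2 ^ Suc i)"

definition block_sum :: "(nat \<Rightarrow> nat) \<Rightarrow> (nat \<Rightarrow> (nat \<Rightarrow> bool) \<Rightarrow> real) \<Rightarrow> (nat \<Rightarrow> bool) \<Rightarrow> real" where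
  "block_sum k w x = (\<Sum>i. block_term k w x i)"

text \<open>An upper bound for the contribution of the digits from position \<open>m\<close> on: the weight at
  position \<open>i\<close> is at most \<open>stage k i + 1 \<le> i + 1\<close>, independently of the blocks \<open>k\<close>. This independence
  allows \<open>k\<close> to be chosen after the weights.\<close>
definition digit_tail :: "nat \<Rightarrow> real" where
  "digit_tail m = (\<Sum>i. (real (i + m) + 1) / 2 ^ Suc (i + m))"

lemma summable_digit_weights: "summable (\<lambda>i. (real i + 1) / 2 ^ Suc i)"
proof -
  have "summable (\<lambda>i. of_nat (Suc i) * (1 / 2 :: real) ^ i)"
    using geometric_deriv_sums[of "1 / 2 :: real"] by (auto simp: sums_iff)
  then have "summable (\<lambda>i. (of_nat (Suc i) * (1 / 2 :: real) ^ i) / 2)"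
    by (rule summable_divide)
  then show ?thesis by (simp add: power_divide field_simps)
qed

lemma digit_tail_small:
  assumes "0 < r"
  shows "\<exists>N. \<forall>m\<ge>N. digit_tail m < r"
proof -
  obtain N where "\<And>m. m \<ge> N \<Longrightarrow> norm (\<Sum>i. (real (i + m) + 1) / 2 ^ Suc (i + m)) < r"
    using suminf_exist_split[OF assms summable_digit_weights] by blast
  then have "digit_tail m < r" if "m \<ge> N" for m
    using that unfolding digit_tail_def real_norm_def by (meson abs_ge_self le_less_trans)
  then show ?thesis by blast
qed

lemma digit_tail_nonneg: "0 \<le> digit_tail m"
  unfolding digit_tail_def
  by (intro suminf_nonneg summable_ignore_initial_segment[OF summable_digit_weights]) simp

lemma block_term_bound:
  assumes "strict_mono k" "\<And>j. \<bar>w j x\<bar> \<le> C * (real j + 1)"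
  shows "\<bar>block_term k w x i\<bar> \<le> C * ((real i + 1) / 2 ^ Suc i)"
proof -
  have "0 \<le> C * (real 0 + 1)" using assms(2)[of 0] by (meson abs_ge_zero order_trans)
  then have "0 \<le> C" by simp
  have "\<bar>block_term k w x i\<bar> = \<bar>w (stage k i) x\<bar> * (of_bool (x i) / 2 ^ Suc i)"
    by (simp add: block_term_def abs_mult)
  also have "\<dots> \<le> (C * (real (stage k i) + 1)) * (1 / 2 ^ Suc i)"
    by (intro mult_mono assms(2)) (use \<open>0 \<le> C\<close> in \<open>auto simp: divide_right_mono\<close>)
  also have "\<dots> \<le> (C * (real i + 1)) * (1 / 2 ^ Suc i)"
    using \<open>0 \<le> C\<close> stage_le_index[OF assms(1), of i] by (intro mult_right_mono mult_left_mono) auto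
  finally show ?thesis by simp
qed

lemma summable_block_term:
  assumes "strict_mono k" "\<And>j. \<bar>w j x\<bar> \<le> C * (real j + 1)"
  shows "summable (block_term k w x)"
  by (rule summable_comparison_test'[OF summable_mult[OF summable_digit_weights, of C], of 0])
    (use block_term_bound[of k w x C, OF assms] in simp)

lemma block_sum_linear:
  assumes "strict_mono k" "\<And>j. \<bar>u j x\<bar> \<le> C * (real j + 1)" "\<And>j. \<bar>v j x\<bar> \<le> D * (real j + 1)"
  shows "p * block_sum k u x + q * block_sum k v x = block_sum k (\<lambda>j y. p * u j y + q * v j y) x"
proof -
  have u: "summable (block_term k u x)" and v: "summable (block_term k v x)"
    using summable_block_term[of k u x C] summable_block_term[of k v x D] assms by auto
  have "p * block_sum k u x + q * block_sum k v x
      = (\<Sum>i. p * block_term k u x i + q * block_term k v x i)"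
    unfolding block_sum_def using suminf_add[OF summable_mult[OF u, of p] summable_mult[OF v, of q]]
    by (simp add: suminf_mult[OF u] suminf_mult[OF v])
  then show ?thesis
    by (simp add: block_sum_def block_term_def distrib_right mult.assoc add_divide_distrib)
qed

text \<open>The digits of block \<open>n\<close> drop out, so that everything after the initial sum up to \<open>k n\<close> is
  contained in the tail from \<open>k (Suc n)\<close>.\<close>
lemma block_sum_approx:
  assumes k: "strict_mono k" and bound: "\<And>j. \<bar>w j x\<bar> \<le> C * (real j + 1)" and "w n x = 0"
  shows "\<bar>block_sum k w x - (\<Sum>i<k n. block_term k w x i)\<bar> \<le> C * digit_tail (k (Suc n))"
proof -
  let ?K = "k (Suc n)"
  have sm: "summable (block_term k w x)" using summable_block_term[of k w x C] k bound by auto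
  have "(\<Sum>i<?K. block_term k w x i) = (\<Sum>i<k n. block_term k w x i)"
  proof (rule sum.mono_neutral_right)
    show "{..<k n} \<subseteq> {..<?K}"
      using strict_monoD[OF k, of n "Suc n"] by auto
    show "\<forall>i\<in>{..<?K} - {..<k n}. block_term k w x i = 0"
      using stage_eq[OF k, of n] \<open>w n x = 0\<close> by (auto simp: block_term_def)
  qed simp
  then have "block_sum k w x - (\<Sum>i<k n. block_term k w x i) = (\<Sum>i. block_term k w x (i + ?K))"
    unfolding block_sum_def suminf_split_initial_segment[OF sm, of ?K] by simp
  also have "\<bar>\<dots>\<bar> \<le> (\<Sum>i. C * ((real (i + ?K) + 1) / 2 ^ Suc (i + ?K)))"
    unfolding real_norm_def[symmetric]
  proof (rule norm_suminf_le)
    show "norm (block_term k w x (i + ?K)) \<le> C * ((real (i + ?K) + 1) / 2 ^ Suc (i + ?K))" for i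
      using block_term_bound[of k w x C "i + ?K", OF k bound] by simp
    show "summable (\<lambda>i. C * ((real (i + ?K) + 1) / 2 ^ Suc (i + ?K)))"
      by (intro summable_mult summable_ignore_initial_segment summable_digit_weights)
  qed
  also have "\<dots> = C * digit_tail ?K"
    unfolding digit_tail_def
    by (intro suminf_mult summable_ignore_initial_segment summable_digit_weights)
  finally show ?thesis .
qed

lemma determined_block_head:
  assumes "strict_mono k" "\<And>j. j \<le> n \<Longrightarrow> determined (k n) (w j)"
  shows "determined (k n) (\<lambda>x. \<Sum>i<k n. block_term k w x i)"
  unfolding determined_def
proof (intro allI sum.cong refl)
  fix x i assume "i \<in> {..<k n}"
  then have i: "i < k n" by simp
  then have "stage k i \<le> n"
    using strict_monoD[OF assms(1), of n "Suc n"] by (intro stage_le) simp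
  then show "block_term k w (trunc (k n) x) i = block_term k w x i"
    using determinedD[OF assms(2)[of "stage k i"], of x] i
    by (simp add: block_term_def) (simp add: trunc_def)
qed

text \<open>The initial part of the sum over \<open>F\<close> depends only on the set of truncations of the elements of
  \<open>F\<close> at \<open>k n\<close>, which is one of at most \<open>2 ^ 2 ^ k n\<close> sets. Injectivity of \<open>trunc l\<close> on \<open>F\<close> makes
  this a set rather than a multiset, and it bounds the cardinality of \<open>F\<close>, and with it the
  accumulated error, by \<open>2 ^ l\<close>.\<close>
lemma block_sums_near_finite_set:
  assumes k: "strict_mono k" and "l \<le> k n"
    and det: "\<And>j. j \<le> n \<Longrightarrow> determined (k n) (w j)"
    and bound: "\<And>j x. \<bar>w j x\<bar> \<le> C * (real j + 1)" and zero: "\<And>x. w n x = 0"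
  shows "\<exists>T. finite T \<and> card T \<le> 2 ^ 2 ^ k n \<and>
     {\<Sum>x\<in>F. block_sum k w x | F. finite F \<and> inj_on (trunc l) F} \<subseteq>
     (\<Union>t\<in>T. cball t (2 ^ l * C * digit_tail (k (Suc n))))"
proof -
  define h where "h x = (\<Sum>i<k n. block_term k w x i)" for x
  have h: "determined (k n) h"
    unfolding h_def by (rule determined_block_head[OF k det])
  let ?R = "range (trunc (k n))"
  define T where "T = (\<lambda>F. \<Sum>x\<in>F. h x) ` Pow ?R"
  have "finite T" unfolding T_def using card_range_trunc(1) by simp
  have "card T \<le> card (Pow ?R)"
    unfolding T_def using card_range_trunc(1) by (intro card_image_le) simp
  also have "\<dots> = 2 ^ card ?R" by (rule card_Pow[OF card_range_trunc(1)])
  also have "\<dots> \<le> 2 ^ 2 ^ k n" using card_range_trunc(2) by (intro power_increasing) auto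
  finally have "card T \<le> 2 ^ 2 ^ k n" .
  moreover have "{\<Sum>x\<in>F. block_sum k w x | F. finite F \<and> inj_on (trunc l) F} \<subseteq>
     (\<Union>t\<in>T. cball t (2 ^ l * C * digit_tail (k (Suc n))))"
  proof clarify
    fix F assume F: "finite F" "inj_on (trunc l) F"
    have inj: "inj_on (trunc (k n)) F"
    proof (rule inj_onI)
      fix x y assume "x \<in> F" "y \<in> F" "trunc (k n) x = trunc (k n) y"
      then have "trunc l (trunc (k n) x) = trunc l (trunc (k n) y)" by simp
      then have "trunc l x = trunc l y"
        using \<open>l \<le> k n\<close> by (simp add: trunc_trunc min_absorb1)
      then show "x = y" using F(2) \<open>x \<in> F\<close> \<open>y \<in> F\<close> by (meson inj_onD)
    qed
    have "(\<Sum>x\<in>F. h x) = (\<Sum>x\<in>trunc (k n) ` F. h x)"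
      unfolding sum.reindex[OF inj] using determinedD[OF h] by simp
    then have inT: "(\<Sum>x\<in>F. h x) \<in> T" unfolding T_def by blast
    have C: "0 \<le> C * digit_tail (k (Suc n))"
      by (rule order_trans[OF abs_ge_zero block_sum_approx[OF k bound zero]])
    have "card F = card (trunc l ` F)" using card_image[OF F(2)] by simp
    also have "\<dots> \<le> card (range (trunc l))"
      by (intro card_mono card_range_trunc(1)) auto
    also have "\<dots> \<le> 2 ^ l" by (rule card_range_trunc(2))
    finally have "real (card F) \<le> real (2 ^ l)" by (rule of_nat_mono)
    then have cF: "real (card F) \<le> 2 ^ l" by simp
    have "\<bar>(\<Sum>x\<in>F. block_sum k w x) - (\<Sum>x\<in>F. h x)\<bar> \<le> (\<Sum>x\<in>F. \<bar>block_sum k w x - h x\<bar>)"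
      unfolding sum_subtractf[symmetric] by (rule sum_abs)
    also have "\<dots> \<le> (\<Sum>x\<in>F. C * digit_tail (k (Suc n)))"
      unfolding h_def using k bound zero by (intro sum_mono block_sum_approx)
    also have "\<dots> = real (card F) * (C * digit_tail (k (Suc n)))" by simp
    also have "\<dots> \<le> 2 ^ l * (C * digit_tail (k (Suc n)))"
      by (rule mult_right_mono[OF cF C])
    finally show "(\<Sum>x\<in>F. block_sum k w x) \<in> (\<Union>t\<in>T. cball t (2 ^ l * C * digit_tail (k (Suc n))))"
      using inT by (intro UN_I) (auto simp: dist_real_def abs_minus_commute mult.assoc)
  qed
  ultimately show ?thesis using \<open>finite T\<close> by blast
qed

text \<open>The terms depend on finitely many digits each and the series converges uniformly.\<close>
lemma continuous_block_sum:
  assumes k: "strict_mono k" and det: "\<And>n. determined n (w n)"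
    and bound: "\<And>j x. \<bar>w j x\<bar> \<le> C * (real j + 1)"
  shows "continuous_on UNIV (block_sum k w)"
proof -
  have "continuous_on UNIV (\<lambda>x. block_term k w x i)" for i
  proof (rule determined_imp_continuous)
    have "determined (Suc i) (w (stage k i))"
      using stage_le_index[OF k, of i] by (intro determined_mono[OF det]) simp
    then show "determined (Suc i) (\<lambda>x. block_term k w x i)"
      by (simp add: determined_def block_term_def) (simp add: trunc_def)
  qed
  then have cont: "\<forall>\<^sub>F n in sequentially. continuous_on UNIV (\<lambda>x. \<Sum>i<n. block_term k w x i)"
    by (intro always_eventually allI continuous_on_sum)
  have "uniform_limit UNIV (\<lambda>n x. \<Sum>i<n. block_term k w x i) (\<lambda>x. \<Sum>i. block_term k w x i) sequentially"
    by (rule Weierstrass_m_test[OF _ summable_mult[OF summable_digit_weights, of C]])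
      (use block_term_bound[OF k bound] in simp)
  then show ?thesis
    unfolding block_sum_def[abs_def] using uniform_limit_theorem[OF cont] by simp
qed

lemma block_sum_unit_weight:
  assumes "\<And>n x. w n x = 1" "(\<lambda>i. of_bool (x i) / 2 ^ Suc i) sums y"
  shows "block_sum k w x = y"
  using assms by (simp add: block_sum_def block_term_def sums_iff)

text \<open>The partial sums are the truncations \<open>\<lfloor>y * 2 ^ n\<rfloor> / 2 ^ n\<close>.\<close>
lemma binary_expansion:
  fixes y :: real
  assumes "0 \<le> y" "y < 1"
  shows "\<exists>x :: nat \<Rightarrow> bool. (\<lambda>i. of_bool (x i) / 2 ^ Suc i) sums y"
proof
  define x where "x i = odd \<lfloor>y * 2 ^ Suc i\<rfloor>" for i :: nat
  have partial: "(\<Sum>i<n. of_bool (x i) / 2 ^ Suc i) = real_of_int \<lfloor>y * 2 ^ n\<rfloor> / 2 ^ n" for n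
  proof (induction n)
    case 0
    then show ?case using assms by (simp add: floor_eq_iff)
  next
    case (Suc n)
    have half: "\<lfloor>y * 2 ^ Suc n\<rfloor> div 2 = \<lfloor>y * 2 ^ n\<rfloor>"
      using floor_divide_real_eq_div[of 2 "y * 2 ^ Suc n"] by simp
    have "\<lfloor>y * 2 ^ Suc n\<rfloor> = 2 * (\<lfloor>y * 2 ^ Suc n\<rfloor> div 2) + of_bool (x n)"
      unfolding x_def by (metis mod_2_eq_odd mult_div_mod_eq)
    then have "real_of_int \<lfloor>y * 2 ^ Suc n\<rfloor> = 2 * of_int \<lfloor>y * 2 ^ n\<rfloor> + of_bool (x n)"
      unfolding half by (metis of_int_add of_int_mult of_int_numeral of_int_of_bool)
    then show ?case using Suc by (simp add: field_simps)
  qed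
  have "(\<lambda>n. of_int \<lfloor>y * 2 ^ n\<rfloor> / 2 ^ n) \<longlonglongrightarrow> y"
  proof (rule tendsto_sandwich)
    show "\<forall>\<^sub>F n in sequentially. y - (1 / 2) ^ n \<le> of_int \<lfloor>y * 2 ^ n\<rfloor> / 2 ^ n"
    proof (intro always_eventually allI)
      fix n :: nat
      have "y * 2 ^ n - 1 \<le> of_int \<lfloor>y * 2 ^ n\<rfloor>" by linarith
      then show "y - (1 / 2) ^ n \<le> of_int \<lfloor>y * 2 ^ n\<rfloor> / 2 ^ n"
        by (simp add: power_divide pos_le_divide_eq left_diff_distrib)
    qed
    show "\<forall>\<^sub>F n in sequentially. of_int \<lfloor>y * 2 ^ n\<rfloor> / 2 ^ n \<le> y"
      by (intro always_eventually allI) (simp add: field_simps)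
    have "(\<lambda>n. y - (1 / 2) ^ n) \<longlonglongrightarrow> y - 0"
      by (intro tendsto_diff tendsto_const LIMSEQ_power_zero) auto
    then show "(\<lambda>n. y - (1 / 2) ^ n) \<longlonglongrightarrow> y" by simp
  qed auto
  then show "(\<lambda>i. of_bool (x i) / 2 ^ Suc i) sums y"
    unfolding sums_def partial .
qed

section \<open>Choice of the blocks and dimension of the generated sums\<close>

text \<open>By compactness \<open>K\<close> has a cover by finitely many balls of positive radius with a very small sum of
  powers. Let \<open>\<rho>\<close> be the smallest radius. Adding a set of diameter comparable to \<open>\<rho>\<close> at most doubles
  each ball, and adding one that consists of \<open>N\<close> such clusters multiplies the number of balls
  by \<open>N\<close>. Both factors are compensated in advance by the choice of the cover.\<close>
lemma sumset_ball_cover_scale: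
  fixes K :: "real set"
  assumes "compact K" "hausdorff_null s K" "0 < s" "0 < \<eta>"
  shows "\<exists>\<rho>>0. \<forall>P T. finite T \<and> card T \<le> N \<and> P \<subseteq> (\<Union>t\<in>T. cball t \<rho>) \<longrightarrow>
           ball_cover s \<eta> {x + y | x y. x \<in> K \<and> y \<in> P}"
proof -
  define \<eta>' where "\<eta>' = \<eta> / (2 powr s * (real N + 1))"
  have "\<eta>' > 0" using \<open>0 < \<eta>\<close> unfolding \<eta>'_def by (intro divide_pos_pos mult_pos_pos) auto
  then have "ball_cover s \<eta>' K" using assms(2) by (simp add: hausdorff_null_def)
  then obtain c r where r: "\<And>i::nat. 0 \<le> r i" and K: "K \<subseteq> (\<Union>i. ball (c i) (r i))"
    and sum: "(\<Sum>i. ennreal (r i powr s)) \<le> ennreal \<eta>'"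
    by (rule ball_coverE) blast
  obtain I0 where I0: "finite I0" "K \<subseteq> (\<Union>i\<in>I0. ball (c i) (r i))"
    using compactE_image[OF \<open>compact K\<close>, of UNIV "\<lambda>i. ball (c i) (r i)"] K by auto
  define I where "I = {i\<in>I0. 0 < r i}"
  have I: "finite I" "\<And>i. i \<in> I \<Longrightarrow> 0 < r i"
    using I0(1) by (auto simp: I_def)
  have IK: "K \<subseteq> (\<Union>i\<in>I. ball (c i) (r i))"
  proof
    fix x assume "x \<in> K"
    then obtain i where i: "i \<in> I0" "x \<in> ball (c i) (r i)" using I0(2) by blast
    then have "i \<in> I" by (auto simp: I_def intro: le_less_trans[OF zero_le_dist])
    then show "x \<in> (\<Union>i\<in>I. ball (c i) (r i))" using i by blast
  qed
  define \<rho> where "\<rho> = Min (insert 1 (r ` I))"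
  have \<rho>: "\<rho> > 0" "\<And>i. i \<in> I \<Longrightarrow> \<rho> \<le> r i"
    using I(1,2) unfolding \<rho>_def by auto

  have "(\<Sum>i\<in>I. ennreal (r i powr s)) \<le> (\<Sum>i. ennreal (r i powr s))"
    by (rule sum_le_suminf[OF summableI I(1)]) (rule zero_le)
  then have "ennreal (\<Sum>i\<in>I. r i powr s) \<le> (\<Sum>i. ennreal (r i powr s))"
    by (subst (asm) sum_ennreal) auto
  then have "ennreal (\<Sum>i\<in>I. r i powr s) \<le> ennreal \<eta>'"
    using sum by (rule order_trans)
  then have sumI: "(\<Sum>i\<in>I. r i powr s) \<le> \<eta>'"
    using \<open>\<eta>' > 0\<close> by simp
  show ?thesis
  proof (intro exI conjI allI impI)
    fix P T :: "real set" assume "finite T \<and> card T \<le> N \<and> P \<subseteq> (\<Union>t\<in>T. cball t \<rho>)"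
    then have T: "finite T" "card T \<le> N" "P \<subseteq> (\<Union>t\<in>T. cball t \<rho>)" by auto
    show "ball_cover s \<eta> {x + y | x y. x \<in> K \<and> y \<in> P}"
    proof (rule ball_cover_finite[where J = "I \<times> T" and r = "\<lambda>p. 2 * r (fst p)"
            and c = "\<lambda>p. c (fst p) + snd p"])
      show "{x + y | x y. x \<in> K \<and> y \<in> P} \<subseteq> (\<Union>p\<in>I \<times> T. ball (c (fst p) + snd p) (2 * r (fst p)))"
      proof clarify
        fix x y assume "x \<in> K" "y \<in> P"
        then obtain i t where "i \<in> I" "x \<in> ball (c i) (r i)" "t \<in> T" "y \<in> cball t \<rho>"
          using IK T(3) by blast
        then show "x + y \<in> (\<Union>p\<in>I \<times> T. ball (c (fst p) + snd p) (2 * r (fst p)))"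
          using \<rho>(2)[of i] by (intro UN_I[of "(i, t)"]) (auto simp: dist_real_def)
      qed
      have "(\<Sum>p\<in>I \<times> T. (2 * r (fst p)) powr s) = (\<Sum>i\<in>I. \<Sum>t\<in>T. (2 * r i) powr s)"
        using sum.cartesian_product[of "\<lambda>i t. (2 * r i) powr s" T I] by (simp add: case_prod_beta)
      also have "\<dots> = card T * 2 powr s * (\<Sum>i\<in>I. r i powr s)"
        using r by (simp add: powr_mult sum_distrib_left mult.assoc)
      also have "\<dots> \<le> (real N + 1) * 2 powr s * \<eta>'"
        using T(2) sumI by (intro mult_mono sum_nonneg) auto
      also have "\<dots> = \<eta>"
        by (simp add: \<eta>'_def)
      finally show "(\<Sum>p\<in>I \<times> T. (2 * r (fst p)) powr s) \<le> \<eta>" .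
    qed (use I T r in auto)
  qed (rule \<rho>(1))
qed

text \<open>The blocks are constructed by recursion: \<open>k (Suc n)\<close> is chosen so that the digit tail from there on
  is below the scale that the preceding lemma provides for \<open>K n\<close> and the number
  \<open>2 ^ 2 ^ k n\<close> of clusters.\<close>
lemma block_scales_exist:
  assumes "\<And>n. compact (K n)" "\<And>n. hausdorff_null (s n) (K n)" "\<And>n. 0 < s n"
  obtains k where "strict_mono k"
    "\<And>n P T. finite T \<Longrightarrow> card T \<le> 2 ^ 2 ^ k n \<Longrightarrow>
       P \<subseteq> (\<Union>t\<in>T. cball t ((real n + 1) * digit_tail (k (Suc n)))) \<Longrightarrow>
       ball_cover (s n) (1 / (real n + 1)) {x + y | x y. x \<in> K n \<and> y \<in> P}"
proof -
  define Q where "Q n m m' \<longleftrightarrow> m < m' \<and>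
     (\<forall>P T. finite T \<and> card T \<le> 2 ^ 2 ^ m \<and>
       P \<subseteq> (\<Union>t\<in>T. cball t ((real n + 1) * digit_tail m')) \<longrightarrow>
       ball_cover (s n) (1 / (real n + 1)) {x + y | x y. x \<in> K n \<and> y \<in> P})" for n m m'
  have "\<exists>m'. Q n m m'" for n m
  proof -
    obtain \<rho> where \<rho>: "\<rho> > 0" and cover: "\<And>P T. finite T \<and> card T \<le> 2 ^ 2 ^ m \<and> P \<subseteq> (\<Union>t\<in>T. cball t \<rho>) \<Longrightarrow>
           ball_cover (s n) (1 / (real n + 1)) {x + y | x y. x \<in> K n \<and> y \<in> P}"
      using sumset_ball_cover_scale[OF assms(1)[of n] assms(2)[of n] assms(3)[of n], of "1 / (real n + 1)" "2 ^ 2 ^ m"]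
      by auto
    obtain N where N: "\<And>m'. m' \<ge> N \<Longrightarrow> digit_tail m' < \<rho> / (real n + 1)"
      using digit_tail_small[of "\<rho> / (real n + 1)"] \<rho> by auto
    define m' where "m' = max N (Suc m)"
    have "(real n + 1) * digit_tail m' \<le> \<rho>"
      using N[of m'] by (simp add: m'_def pos_less_divide_eq mult.commute)
    then have sub: "(\<Union>t\<in>T. cball t ((real n + 1) * digit_tail m')) \<subseteq> (\<Union>t\<in>T. cball t \<rho>)" for T :: "real set"
      by (intro UN_mono subset_cball) auto
    have "Q n m m'"
      unfolding Q_def
    proof (intro conjI allI impI)
      show "m < m'" by (simp add: m'_def)
      fix P T :: "real set" assume "finite T \<and> card T \<le> 2 ^ 2 ^ m \<and> P \<subseteq> (\<Union>t\<in>T. cball t ((real n + 1) * digit_tail m'))"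
      then show "ball_cover (s n) (1 / (real n + 1)) {x + y | x y. x \<in> K n \<and> y \<in> P}"
        using sub[of T] by (intro cover[of T]) auto
    qed
    then show ?thesis ..
  qed
  then obtain k where k: "\<And>n. Q n (k n) (k (Suc n))"
    using dependent_nat_choice[of "\<lambda>_ _. True" Q] by auto
  show thesis
  proof (rule that)
    show "strict_mono k"
      using k by (simp add: strict_mono_Suc_iff Q_def)
  qed (use k in \<open>auto simp: Q_def\<close>)
qed

text \<open>The set is a countable union of pieces \<open>X j l g\<close>, in which \<open>b\<close> comes from \<open>K j\<close>, the elements of
  \<open>F\<close> are separated by their first \<open>l\<close> digits, and the coefficients are the values of a function
  \<open>g\<close> of these digits. For one piece, the weights annihilate \<open>g\<close> in infinitely many blocks;
  a late one among these yields a cover with an exponent \<open>d + 1 / (n + 1) \<le> t\<close> and an arbitrarily small sum.\<close>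
lemma hausdorff_null_generated_sums:
  fixes u v :: "nat \<Rightarrow> (nat \<Rightarrow> bool) \<Rightarrow> real" and K :: "nat \<Rightarrow> real set"
  assumes k: "strict_mono k"
    and det: "\<And>n. determined n (u n)" "\<And>n. determined n (v n)"
    and bound: "\<And>n x. \<bar>u n x\<bar> \<le> real n + 1" "\<And>n x. \<bar>v n x\<bar> \<le> real n + 1"
    and kill: "\<And>l (g :: (nat \<Rightarrow> bool) \<Rightarrow> int \<times> int) N. determined l g \<Longrightarrow>
       \<exists>n\<ge>N. \<forall>x. of_int (fst (g x)) * u n x + of_int (snd (g x)) * v n x = 0"
    and K: "incseq K"
    and scale: "\<And>n P T. finite T \<Longrightarrow> card T \<le> 2 ^ 2 ^ k n \<Longrightarrow>
       P \<subseteq> (\<Union>t\<in>T. cball t ((real n + 1) * digit_tail (k (Suc n)))) \<Longrightarrow>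
       ball_cover (d + 1 / (real n + 1)) (1 / (real n + 1)) {x + y | x y. x \<in> K n \<and> y \<in> P}"
    and "0 \<le> d" "d < t"
  shows "hausdorff_null t {b + (\<Sum>x\<in>F. of_int (fst (h x)) * block_sum k u x + of_int (snd (h x)) * block_sum k v x) |
     b F (h :: (nat \<Rightarrow> bool) \<Rightarrow> int \<times> int). b \<in> (\<Union>j. K j) \<and> finite F}"
proof -
  define e :: "int \<times> int \<Rightarrow> (nat \<Rightarrow> bool) \<Rightarrow> real"
    where "e c x = of_int (fst c) * block_sum k u x + of_int (snd c) * block_sum k v x" for c x
  define X where "X j l g = {b + (\<Sum>x\<in>F. e (g x) x) | b F. b \<in> K j \<and> finite F \<and> inj_on (trunc l) F}"
    for j l and g :: "(nat \<Rightarrow> bool) \<Rightarrow> int \<times> int"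
  have null: "hausdorff_null t (X j l g)" if g: "determined l g" for j l g
    unfolding hausdorff_null_def
  proof (intro allI impI)
    fix \<eta> :: real assume "0 < \<eta>"
    have "finite ((\<lambda>c. max \<bar>fst c\<bar> \<bar>snd c\<bar>) ` range g)"
      using determined_finite_range[OF g] by simp
    then obtain M where M: "\<And>x. max \<bar>fst (g x)\<bar> \<bar>snd (g x)\<bar> \<le> M"
      by (meson bdd_above_finite bdd_above.E image_eqI rangeI)
    define C where "C = 2 * real_of_int M"
    define w where "w i x = of_int (fst (g x)) * u i x + of_int (snd (g x)) * v i x" for i x
    have g_le: "\<bar>real_of_int (fst (g x))\<bar> \<le> M" "\<bar>real_of_int (snd (g x))\<bar> \<le> M" for x
      using M[of x] by linarith+
    have w_le: "\<bar>w i x\<bar> \<le> C * (real i + 1)" for i x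
    proof -
      have "0 \<le> real_of_int M" using g_le(1)[of x] by linarith
      then have "\<bar>of_int (fst (g x)) * u i x\<bar> \<le> M * (real i + 1)" "\<bar>of_int (snd (g x)) * v i x\<bar> \<le> M * (real i + 1)"
        unfolding abs_mult using g_le[of x] bound[of i x] by (auto intro!: mult_mono)
      then show ?thesis
        unfolding w_def C_def by (simp add: distrib_right)
    qed
    have e_eq: "e (g x) x = block_sum k w x" for x
      using block_sum_linear[OF k, of u x 1 v 1 "of_int (fst (g x))" "of_int (snd (g x))"] bound
      by (simp add: e_def w_def block_sum_def block_term_def)
    \<comment> \<open>The three bounds make the accumulated error fit the scale of block \<open>n\<close>, the exponent drop
      below \<open>t\<close>, and the total drop below \<open>\<eta>\<close>.\<close>
    obtain N :: nat where N: "real N \<ge> max (2 ^ l * C) (max (1 / (t - d)) (1 / \<eta>))"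
      using real_arch_simple by blast
    obtain n where n: "n \<ge> max N (max l j)" and n0: "\<And>x. w n x = 0"
      using kill[OF g, of "max N (max l j)"] by (auto simp: w_def)
    have nN: "real N \<le> real n + 1" using n by linarith
    have kn: "n \<le> k n" by (rule strict_mono_imp_increasing[OF k])
    have wdet: "determined (k n) (w i)" if "i \<le> n" for i
    proof -
      have "determined (k n) g" "determined (k n) (u i)" "determined (k n) (v i)"
        using determined_mono[OF g] determined_mono[OF det(1)] determined_mono[OF det(2)] n kn that by auto
      then show ?thesis by (simp add: determined_def w_def)
    qed
    define P where "P = {\<Sum>x\<in>F. block_sum k w x | F. finite F \<and> inj_on (trunc l) F}"
    have "l \<le> k n" using n kn by simp
    have "\<exists>T. finite T \<and> card T \<le> 2 ^ 2 ^ k n \<and> P \<subseteq> (\<Union>t\<in>T. cball t (2 ^ l * C * digit_tail (k (Suc n))))"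
      unfolding P_def by (rule block_sums_near_finite_set[OF k \<open>l \<le> k n\<close> wdet w_le n0])
    then obtain T where T: "finite T" "card T \<le> 2 ^ 2 ^ k n"
      and PT: "P \<subseteq> (\<Union>t\<in>T. cball t (2 ^ l * C * digit_tail (k (Suc n))))"
      by blast
    have "2 ^ l * C * digit_tail (k (Suc n)) \<le> (real n + 1) * digit_tail (k (Suc n))"
      using N nN by (intro mult_right_mono digit_tail_nonneg) simp
    then have "(\<Union>t\<in>T. cball t (2 ^ l * C * digit_tail (k (Suc n)))) \<subseteq> (\<Union>t\<in>T. cball t ((real n + 1) * digit_tail (k (Suc n))))"
      by (intro UN_mono subset_cball) auto
    with PT have "P \<subseteq> (\<Union>t\<in>T. cball t ((real n + 1) * digit_tail (k (Suc n))))" by (rule order_trans)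
    with T have "ball_cover (d + 1 / (real n + 1)) (1 / (real n + 1)) {x + y | x y. x \<in> K n \<and> y \<in> P}"
      by (rule scale)
    moreover have "d + 1 / (real n + 1) \<le> t"
    proof -
      have "1 / (t - d) \<le> real n + 1" using N nN by simp
      then show ?thesis using \<open>d < t\<close> by (simp add: field_simps)
    qed
    ultimately have "ball_cover t (1 / (real n + 1)) {x + y | x y. x \<in> K n \<and> y \<in> P}"
      using \<open>0 \<le> d\<close> by (elim ball_cover_exponent_mono) (auto intro: add_nonneg_pos)
    moreover have "X j l g \<subseteq> {x + y | x y. x \<in> K n \<and> y \<in> P}"
    proof
      fix z assume "z \<in> X j l g"
      then obtain b F where z: "z = b + (\<Sum>x\<in>F. block_sum k w x)" "b \<in> K j" "finite F" "inj_on (trunc l) F"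
        unfolding X_def e_eq by blast
      then have "(\<Sum>x\<in>F. block_sum k w x) \<in> P" unfolding P_def by blast
      moreover have "b \<in> K n" using incseqD[OF K, of j n] n z(2) by auto
      ultimately show "z \<in> {x + y | x y. x \<in> K n \<and> y \<in> P}" using z(1) by blast
    qed
    moreover have "1 / (real n + 1) \<le> \<eta>"
    proof -
      have "1 / \<eta> \<le> real n + 1" using N nN by simp
      then show ?thesis using \<open>0 < \<eta>\<close> by (simp add: field_simps)
    qed
    ultimately show "ball_cover t \<eta> (X j l g)" by (rule ball_cover_mono)
  qed
  have "countable {g :: (nat \<Rightarrow> bool) \<Rightarrow> int \<times> int. determined l g}" for l
    by (rule countable_subset[OF _ countable_determined]) auto
  then have "hausdorff_null t (\<Union>j. \<Union>l. \<Union>g\<in>{g. determined l g}. X j l g)"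
    by (rule hausdorff_null_UN[OF hausdorff_null_UN[OF hausdorff_null_countable_UN]]) (simp add: null)
  then show ?thesis
  proof (rule hausdorff_null_subset)
    show "{b + (\<Sum>x\<in>F. of_int (fst (h x)) * block_sum k u x + of_int (snd (h x)) * block_sum k v x) |
         b F (h :: (nat \<Rightarrow> bool) \<Rightarrow> int \<times> int). b \<in> (\<Union>j. K j) \<and> finite F}
       \<subseteq> (\<Union>j. \<Union>l. \<Union>g\<in>{g. determined l g}. X j l g)"
      unfolding e_def[symmetric]
    proof clarify
      fix b j F and h :: "(nat \<Rightarrow> bool) \<Rightarrow> int \<times> int"
      assume b: "b \<in> K j" and F: "finite (F :: (nat \<Rightarrow> bool) set)"
      obtain l where l: "inj_on (trunc l) F" using finite_separating_level[OF F] by blast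
      obtain g where g: "determined l g" "\<forall>x\<in>F. g x = h x" using determined_interpolation[OF l] by blast
      have "b + (\<Sum>x\<in>F. e (h x) x) = b + (\<Sum>x\<in>F. e (g x) x)" using g(2) by simp
      moreover have "b + (\<Sum>x\<in>F. e (g x) x) \<in> X j l g"
        unfolding X_def mem_Collect_eq using b F l by (intro exI[of _ b] exI[of _ F] conjI refl)
      ultimately have "b + (\<Sum>x\<in>F. e (h x) x) \<in> X j l g" by (simp only:)
      then show "b + (\<Sum>x\<in>F. e (h x) x) \<in> (\<Union>j. \<Union>l. \<Union>g\<in>{g. determined l g}. X j l g)"
        using g(1) by (intro UN_I[of j] UN_I[of l] UN_I[of g]) simp_all
    qed
  qed
qed

section \<open>Sums of finitely many compact families\<close>

text \<open>Lists of coefficients, with repetitions, keep both properties visible: for a fixed list the sums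
  form a compact set, and concatenating lists adds the sums.\<close>
primrec sumset :: "('c \<Rightarrow> real set) \<Rightarrow> 'c list \<Rightarrow> real set" where
  "sumset S [] = {0}"
| "sumset S (c # L) = {s + t | s t. s \<in> S c \<and> t \<in> sumset S L}"

lemma compact_sumset: "(\<And>c. compact (S c)) \<Longrightarrow> compact (sumset S L)"
  by (induction L) (auto intro: compact_sums)

lemma sumset_append: "s \<in> sumset S L \<Longrightarrow> t \<in> sumset S M \<Longrightarrow> s + t \<in> sumset S (L @ M)"
proof (induction L arbitrary: s)
  case (Cons c L)
  then obtain a b where "s = a + b" "a \<in> S c" "b \<in> sumset S L" by auto
  then have "a + (b + t) \<in> sumset S ((c # L) @ M)"
    using Cons.IH[of b] Cons.prems(2) unfolding append_Cons sumset.simps by blast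
  then show ?case using \<open>s = a + b\<close> by (simp add: add.assoc)
qed simp

lemma sumset_uminus:
  assumes "\<And>c s. s \<in> S c \<Longrightarrow> - s \<in> S (- c)"
  shows "t \<in> sumset S L \<Longrightarrow> - t \<in> sumset S (map uminus L)"
proof (induction L arbitrary: t)
  case (Cons c L)
  then obtain a b where "t = a + b" "a \<in> S c" "b \<in> sumset S L" by auto
  then have "- a + - b \<in> sumset S (map uminus (c # L))"
    using Cons.IH[of b] assms[of a c] unfolding list.map sumset.simps by blast
  then show ?case using \<open>t = a + b\<close> by simp
qed simp

text \<open>The summands are regrouped by their parameter \<open>x\<close>, adding up the coefficients that belong to the
  same \<open>x\<close>. This is what makes the sums accessible to the annihilation argument, where
  distinct summands have to be separated by their digits.\<close>
lemma sumset_collect: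
  fixes e :: "'c::monoid_add \<Rightarrow> 'x \<Rightarrow> real"
  assumes add: "\<And>c c' x. e (c + c') x = e c x + e c' x" and zero: "\<And>x. e 0 x = 0"
    and "t \<in> sumset (\<lambda>c. range (e c)) L"
  shows "\<exists>F h. finite F \<and> t = (\<Sum>x\<in>F. e (h x) x)"
  using assms(3)
proof (induction L arbitrary: t)
  case Nil
  then show ?case by (auto intro!: exI[of _ "{}"])
next
  case (Cons c L)
  then obtain y t' where t: "t = e c y + t'" "t' \<in> sumset (\<lambda>c. range (e c)) L" by auto
  then obtain F h where F: "finite F" "t' = (\<Sum>x\<in>F. e (h x) x)" using Cons.IH by blast
  define h' where "h' x = (if x = y then c else 0) + (if x \<in> F then h x else 0)" for x
  have "(\<Sum>x\<in>insert y F. e (h' x) x)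
      = (\<Sum>x\<in>insert y F. e (if x = y then c else 0) x) + (\<Sum>x\<in>insert y F. e (if x \<in> F then h x else 0) x)"
    by (simp add: h'_def add sum.distrib)
  also have "(\<Sum>x\<in>insert y F. e (if x = y then c else 0) x) = (\<Sum>x\<in>{y}. e c x)"
    using F(1) zero by (intro sum.mono_neutral_cong_right) auto
  also have "(\<Sum>x\<in>insert y F. e (if x \<in> F then h x else 0) x) = (\<Sum>x\<in>F. e (h x) x)"
    using F(1) zero by (intro sum.mono_neutral_cong_right) auto
  finally have "t = (\<Sum>x\<in>insert y F. e (h' x) x)"
    using t F by simp
  then show ?case using F(1) by blast
qed

section \<open>The subgroup\<close>

theorem theorem2p1:
  fixes B :: "real set" and \<xi> :: real
  assumes "subgroup B real_add_group"
    and "fsigma B"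
    and "\<xi> \<notin> \<rat>"
  shows "\<exists>A :: real set. subgroup A real_add_group \<and> fsigma A \<and>
           B \<subseteq> A \<and> hausdorff_dim A = hausdorff_dim B \<and>
           {a + \<xi> * b | a b. a \<in> A \<and> b \<in> A} = UNIV"
proof (cases "hausdorff_dim B = \<infinity>")
  case True
  \<comment> \<open>By monotonicity the line then has the same dimension as \<open>B\<close>.\<close>
  have "x \<in> {a + \<xi> * b | a b. a \<in> UNIV \<and> b \<in> UNIV}" for x
    by (rule CollectI, rule exI[of _ x], rule exI[of _ 0]) simp
  then have "{a + \<xi> * b | a b. a \<in> UNIV \<and> b \<in> UNIV} = UNIV" by blast
  moreover have "hausdorff_dim (UNIV :: real set) = hausdorff_dim B"
    using hausdorff_dim_mono[of B UNIV] True by (simp add: top_unique infinity_ennreal_def)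
  ultimately show ?thesis
    by (intro exI[of _ UNIV] conjI) (simp_all add: subgroup_real_add_group_iff)
next
  case False
  then obtain d where d: "hausdorff_dim B = ennreal d" "0 \<le> d"
    by (cases "hausdorff_dim B") (auto simp: infinity_ennreal_def)
  have B: "0 \<in> B" "\<And>x y. x \<in> B \<Longrightarrow> y \<in> B \<Longrightarrow> x + y \<in> B" "\<And>x. x \<in> B \<Longrightarrow> - x \<in> B"
    using assms(1) by (auto simp: subgroup_real_add_group_iff)
  obtain C :: "nat \<Rightarrow> real set" where "range C \<subseteq> Collect compact" and BC: "B = (\<Union>n. C n)"
    using assms(2) unfolding fsigma_Union_compact by blast
  then have C: "compact (C n)" for n by auto
  \<comment> \<open>The sets have to increase because a given piece is only covered at certain late stages.\<close>
  define K where "K n = (\<Union>i\<le>n. C i)" for n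
  have K: "incseq K" "\<And>n. compact (K n)" "(\<Union>n. K n) = B"
  proof -
    show "incseq K" unfolding K_def by (intro monoI UN_mono) auto
    show "compact (K n)" for n unfolding K_def using C by (intro compact_UN) auto
    show "(\<Union>n. K n) = B" unfolding K_def BC by auto
  qed
  obtain u v where det: "\<And>n. determined n (u n)" "\<And>n. determined n (v n)"
    and bound: "\<And>n x. \<bar>u n x\<bar> \<le> real n + 1" "\<And>n x. \<bar>v n x\<bar> \<le> real n + 1"
    and unit: "\<And>n x. u n x + \<xi> * v n x = 1"
    and kill: "\<And>l (g :: (nat \<Rightarrow> bool) \<Rightarrow> int \<times> int) N. determined l g \<Longrightarrow>
       \<exists>n\<ge>N. \<forall>x. of_int (fst (g x)) * u n x + of_int (snd (g x)) * v n x = 0"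
    using annihilating_weights[OF assms(3)] by blast
  have "hausdorff_null (d + 1 / (real n + 1)) (K n)" for n
  proof (rule hausdorff_null_subset)
    show "hausdorff_null (d + 1 / (real n + 1)) B"
      using d by (intro hausdorff_null_above_dim) (simp add: ennreal_less_iff)
    show "K n \<subseteq> B" using K(3) by blast
  qed
  moreover have "0 < d + 1 / (real n + 1)" for n :: nat
    using d(2) by (intro add_nonneg_pos) auto
  ultimately obtain k where k: "strict_mono k" and scale:
    "\<And>n P T. finite T \<Longrightarrow> card T \<le> 2 ^ 2 ^ k n \<Longrightarrow>
       P \<subseteq> (\<Union>t\<in>T. cball t ((real n + 1) * digit_tail (k (Suc n)))) \<Longrightarrow>
       ball_cover (d + 1 / (real n + 1)) (1 / (real n + 1)) {x + y | x y. x \<in> K n \<and> y \<in> P}"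
    using block_scales_exist[of K "\<lambda>n. d + 1 / (real n + 1)", OF K(2)] by blast
  define e :: "int \<times> int \<Rightarrow> (nat \<Rightarrow> bool) \<Rightarrow> real"
    where "e c x = of_int (fst c) * block_sum k u x + of_int (snd c) * block_sum k v x" for c x
  define E where "E = sumset (\<lambda>c. range (e c))"
  define A where "A = {b + t | b t L. b \<in> B \<and> t \<in> E L}"
  have cont: "continuous_on UNIV (block_sum k u)" "continuous_on UNIV (block_sum k v)"
    using continuous_block_sum[of k u 1, OF k det(1)] continuous_block_sum[of k v 1, OF k det(2)] bound by auto
  have compact_E: "compact (E L)" for L
    unfolding E_def
  proof (rule compact_sumset)
    show "compact (range (e c))" for c
      unfolding e_def by (intro compact_continuous_image compact_Cantor_space continuous_intros cont)
  qed
  have "subgroup A real_add_group"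
    unfolding subgroup_real_add_group_iff
  proof (intro conjI ballI)
    have "0 \<in> E []" by (simp add: E_def)
    then show "0 \<in> A" unfolding A_def using B(1) by force
    fix x assume "x \<in> A"
    then obtain b t L where x: "x = b + t" "b \<in> B" "t \<in> E L" unfolding A_def by blast
    have "- t \<in> E (map uminus L)"
      using x(3) unfolding E_def by (rule sumset_uminus[rotated]) (auto simp: e_def)
    then have "- b + - t \<in> A" unfolding A_def using B(3)[OF x(2)] by blast
    then show "- x \<in> A" using x(1) by simp
    fix y assume "y \<in> A"
    then obtain b' t' L' where y: "y = b' + t'" "b' \<in> B" "t' \<in> E L'" unfolding A_def by blast
    have "t + t' \<in> E (L @ L')"
      using x(3) y(3) unfolding E_def by (rule sumset_append)
    then have "(b + b') + (t + t') \<in> A" unfolding A_def using B(2)[OF x(2) y(2)] by blast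
    then show "x + y \<in> A" using x(1) y(1) by (simp add: algebra_simps)
  qed
  moreover have "fsigma A"
  proof -
    define G :: "nat \<times> (int \<times> int) list \<Rightarrow> real set"
      where "G p = {b + t | b t. b \<in> K (fst p) \<and> t \<in> E (snd p)}" for p
    have "closed (G p)" for p
      unfolding G_def by (intro compact_imp_closed compact_sums K(2) compact_E)
    then have "fsigma (\<Union>n. G (from_nat n))" by (rule fsigma.intros)
    also have "(\<Union>n. G (from_nat n)) = (\<Union>p. G p)"
      by (metis surj_from_nat image_image)
    also have "\<dots> = A"
      unfolding G_def A_def K(3)[symmetric] by auto blast
    finally show ?thesis .
  qed
  moreover have BA: "B \<subseteq> A"
  proof
    fix b assume "b \<in> B"
    moreover have "0 \<in> E []" by (simp add: E_def)
    ultimately have "b + 0 \<in> A" unfolding A_def by blast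
    then show "b \<in> A" by simp
  qed
  moreover have "hausdorff_dim A = hausdorff_dim B"
  proof (rule antisym)
    have "hausdorff_null t A" if "d < t" for t
    proof (rule hausdorff_null_subset[OF hausdorff_null_generated_sums[OF k det bound kill K(1) scale d(2) that]])
      have "\<exists>F h. finite F \<and> t = (\<Sum>x\<in>F. e (h x) x)" if "t \<in> E L" for t L
        using that unfolding E_def
        by (rule sumset_collect[rotated 2]) (auto simp: e_def algebra_simps)
      then show "A \<subseteq> {b + (\<Sum>x\<in>F. of_int (fst (h x)) * block_sum k u x + of_int (snd (h x)) * block_sum k v x) |
           b F (h :: (nat \<Rightarrow> bool) \<Rightarrow> int \<times> int). b \<in> (\<Union>j. K j) \<and> finite F}"
        unfolding A_def K(3) e_def[symmetric] by blast
    qed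
    then show "hausdorff_dim A \<le> hausdorff_dim B"
      unfolding d(1) using d(2) by (rule hausdorff_dim_le[rotated])
    show "hausdorff_dim B \<le> hausdorff_dim A" using BA by (rule hausdorff_dim_mono)
  qed
  moreover have "{a + \<xi> * b | a b. a \<in> A \<and> b \<in> A} = UNIV"
  proof -
    have in_A: "block_sum k u x \<in> A" "block_sum k v x \<in> A" for x
    proof -
      have "block_sum k u x \<in> E [(1, 0)]" "block_sum k v x \<in> E [(0, 1)]"
        by (auto simp: E_def e_def)
      then have "0 + block_sum k u x \<in> A" "0 + block_sum k v x \<in> A"
        unfolding A_def using B(1) by blast+
      then show "block_sum k u x \<in> A" "block_sum k v x \<in> A" by simp_all
    qed
    have plus: "x + y \<in> A" if "x \<in> A" "y \<in> A" for x y
      using \<open>subgroup A real_add_group\<close> that by (simp add: subgroup_real_add_group_iff)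
    have minus: "- x \<in> A" if "x \<in> A" for x
      using \<open>subgroup A real_add_group\<close> that by (simp add: subgroup_real_add_group_iff)
    have zero: "0 \<in> A"
      using \<open>subgroup A real_add_group\<close> by (simp add: subgroup_real_add_group_iff)
    have unit_interval: "\<exists>a b. y = a + \<xi> * b \<and> a \<in> A \<and> b \<in> A" if y: "0 \<le> y" "y < 1" for y
    proof -
      obtain x where x: "(\<lambda>i. of_bool (x i) / 2 ^ Suc i) sums y" using binary_expansion[OF y] by blast
      \<comment> \<open>Since \<open>u + \<xi> v = 1\<close>, the combined series is the plain binary expansion.\<close>
      have "block_sum k u x + \<xi> * block_sum k v x = block_sum k (\<lambda>j z. u j z + \<xi> * v j z) x"
        using block_sum_linear[OF k, of u x 1 v 1 1 \<xi>] bound by simp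
      also have "\<dots> = y"
        by (rule block_sum_unit_weight[OF _ x]) (rule unit)
      finally show ?thesis using in_A by metis
    qed
    have "\<exists>a b. real m * y = a + \<xi> * b \<and> a \<in> A \<and> b \<in> A" if y: "0 \<le> y" "y < 1" for y m
    proof (induction m)
      case 0
      then show ?case using zero by (auto intro!: exI[of _ 0])
    next
      case (Suc m)
      then obtain a b where "real m * y = a + \<xi> * b" "a \<in> A" "b \<in> A" by blast
      moreover obtain a' b' where "y = a' + \<xi> * b'" "a' \<in> A" "b' \<in> A" using unit_interval[OF y] by blast
      ultimately have "real (Suc m) * y = (a + a') + \<xi> * (b + b')" "a + a' \<in> A" "b + b' \<in> A"
        by (auto simp: algebra_simps intro: plus)
      then show ?case by blast
    qed
    note multiples = this
    have nonneg: "\<exists>a b. z = a + \<xi> * b \<and> a \<in> A \<and> b \<in> A" if "0 \<le> z" for z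
    proof -
      obtain m :: nat where m: "z < real m" using reals_Archimedean2 by blast
      then have "0 \<le> z / real m" "z / real m < 1" "real m * (z / real m) = z"
        using that by auto
      then show ?thesis using multiples[of "z / real m" m] by simp
    qed
    have "\<exists>a b. z = a + \<xi> * b \<and> a \<in> A \<and> b \<in> A" for z
    proof (cases "0 \<le> z")
      case False
      then obtain a b where "- z = a + \<xi> * b" "a \<in> A" "b \<in> A" using nonneg[of "- z"] by auto
      then have "z = - a + \<xi> * - b" "- a \<in> A" "- b \<in> A" by (auto intro: minus)
      then show ?thesis by blast
    qed (rule nonneg)
    then show ?thesis by blast
  qed
  ultimately show ?thesis by blast
qed

end
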